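(* Let $F=\{f_n\}_{n\in\mathbb N}$ be a time varying bi-measurable map on a separable metric space $(X,d)$. If $\mu$ is an outer regular non-atomic Borel measure on $X$ which is expansive with respect to $F$, then the set $A(F)$ of points with converging semiorbits under $F$ has measure zero with respect to $\mu$.
   Context: $\mathbb N$ denotes the non-negative integers. A bi-measurable map is a Borel measurable bijection with Borel measurable inverse. A time varying bi-measurable map on $X$ is a family $F=\{f_n\}_{n\in\mathbb N}$ of bi-measurable maps $f_n:X\to X$ with $f_0=\mathrm{id}_X$. Put $F_n=f_n\circ\cdots\circ f_1\circ f_0$ for $n\ge 0$ and $F_n=f_{-n}^{-1}\circ f_{-(n-1)}^{-1}\circ\cdots\circ f_1^{-1}\circ f_0^{-1}$ for $n<0$. A Borel measure $\mu$ is non-atomic if $\mu(\{x\})=0$ for all $x$. A non-atomic Borel measure $\mu$ is expansive with respect to $F$ if there is $\delta>0$ such that $\mu(\Gamma_\delta(x))=0$ for all $x\in X$, where $\Gamma_\delta(x)=\{y\in X: d(F_n(x),F_n(y))\le\delta\text{ for all }n\in\mathbb Z\}$. The $\omega$-limit set $\omega(F,x)$ (resp. $\alpha$-limit set $\alpha(F,x)$) of $x\in X$ is the set of $y\in X$ such that $\lim_{k\to\infty}d(F_{n_k}(x),y)=0$ for some strictly increasing (resp. strictly decreasing) sequence of integers $(n_k)$. A point $x$ has converging semiorbits under $F$ if both $\alpha(F,x)$ and $\omega(F,x)$ consist of a single point; $A(F)$ is the set of all such points.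
   Formalization: Converging semiorbits here also requires F_n(x) to converge to the single limit points as n→±∞ (automatic for compact X); with one-point limit sets alone the claim fails, e.g. for Lebesgue measure on R with F_n(x)=a_n x, F_{-n}(x)=x/a_n, a_n=1/n (n>0 even), n (n odd), a_0=1. *)

theory Defs
  imports "HOL-Analysis.Analysis"
begin

definition bimeasurable :: "('a::topological_space \<Rightarrow> 'a) \<Rightarrow> bool" where
  "bimeasurable g \<longleftrightarrow>
     bij g \<and> g \<in> borel_measurable borel \<and> inv g \<in> borel_measurable borel"

definition time_varying_bimeasurable :: "(nat \<Rightarrow> 'a::topological_space \<Rightarrow> 'a) \<Rightarrow> bool" where
  "time_varying_bimeasurable f \<longleftrightarrow> f 0 = id \<and> (\<forall>n. bimeasurable (f n))"

primrec forward_iterate :: "(nat \<Rightarrow> 'a \<Rightarrow> 'a) \<Rightarrow> nat \<Rightarrow> 'a \<Rightarrow> 'a" where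
  "forward_iterate f 0 = f 0"
| "forward_iterate f (Suc n) = f (Suc n) \<circ> forward_iterate f n"

(* Not the inverse of forward_iterate: the inverses are composed in the order
   inv (f n) o ... o inv (f 1) o inv (f 0). *)
primrec backward_iterate :: "(nat \<Rightarrow> 'a \<Rightarrow> 'a) \<Rightarrow> nat \<Rightarrow> 'a \<Rightarrow> 'a" where
  "backward_iterate f 0 = inv (f 0)"
| "backward_iterate f (Suc n) = inv (f (Suc n)) \<circ> backward_iterate f n"

definition tv_iterate :: "(nat \<Rightarrow> 'a \<Rightarrow> 'a) \<Rightarrow> int \<Rightarrow> 'a \<Rightarrow> 'a" where
  "tv_iterate f n = (if 0 \<le> n then forward_iterate f (nat n) else backward_iterate f (nat (- n)))"

definition outer_regular_measure :: "'a::topological_space measure \<Rightarrow> bool" where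
  "outer_regular_measure M \<longleftrightarrow>
     (\<forall>B\<in>sets M. emeasure M B = (INF U\<in>{U. open U \<and> B \<subseteq> U}. emeasure M U))"

definition non_atomic :: "'a measure \<Rightarrow> bool" where
  "non_atomic M \<longleftrightarrow> (\<forall>x. emeasure M {x} = 0)"

definition dynamical_ball :: "(nat \<Rightarrow> 'a::metric_space \<Rightarrow> 'a) \<Rightarrow> real \<Rightarrow> 'a \<Rightarrow> 'a set" where
  "dynamical_ball f \<delta> x = {y. \<forall>n. dist (tv_iterate f n x) (tv_iterate f n y) \<le> \<delta>}"

definition expansive_measure :: "(nat \<Rightarrow> 'a::metric_space \<Rightarrow> 'a) \<Rightarrow> 'a measure \<Rightarrow> bool" where
  "expansive_measure f M \<longleftrightarrow>
     (\<exists>\<delta>>0. \<forall>x. emeasure M (dynamical_ball f \<delta> x) = 0)"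

definition omega_limit_set :: "(nat \<Rightarrow> 'a::metric_space \<Rightarrow> 'a) \<Rightarrow> 'a \<Rightarrow> 'a set" where
  "omega_limit_set f x =
     {y. \<exists>s::nat \<Rightarrow> int. strict_mono s \<and> (\<lambda>k. dist (tv_iterate f (s k) x) y) \<longlonglongrightarrow> 0}"

definition alpha_limit_set :: "(nat \<Rightarrow> 'a::metric_space \<Rightarrow> 'a) \<Rightarrow> 'a \<Rightarrow> 'a set" where
  "alpha_limit_set f x =
     {y. \<exists>s::nat \<Rightarrow> int. strict_antimono_on UNIV s \<and> (\<lambda>k. dist (tv_iterate f (s k) x) y) \<longlonglongrightarrow> 0}"

(* Each limit set is a single point and the corresponding semiorbit converges to it.
   On a compact space the convergence clauses are redundant (converging_semiorbits_compact).
   On a non-compact space they are not: a semiorbit with one cluster point may also have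
   subsequences without any.  For F n x = a n * x and F (- n) x = x / a n on the reals, with
   a 0 = 1, a n = 1 / n for even n > 0 and a n = n for odd n, all limit sets are {0}, while every
   dynamical ball is a point; so Lebesgue measure is expansive although it does not vanish
   on the set of points with one-point limit sets. *)
definition converging_semiorbits :: "(nat \<Rightarrow> 'a::metric_space \<Rightarrow> 'a) \<Rightarrow> 'a \<Rightarrow> bool" where
  "converging_semiorbits f x \<longleftrightarrow>
     (\<exists>p q. alpha_limit_set f x = {p} \<and> omega_limit_set f x = {q} \<and>
            ((\<lambda>n. tv_iterate f n x) \<longlongrightarrow> p) at_bot \<and>
            ((\<lambda>n. tv_iterate f n x) \<longlongrightarrow> q) at_top)"

definition converging_points :: "(nat \<Rightarrow> 'a::metric_space \<Rightarrow> 'a) \<Rightarrow> 'a set" where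
  "converging_points f = {x. converging_semiorbits f x}"

lemma unique_cluster_point_tendsto:
  fixes g :: "nat \<Rightarrow> 'a::metric_space"
  assumes "compact (UNIV :: 'a set)"
    and "\<And>r y. strict_mono r \<Longrightarrow> (g \<circ> r) \<longlonglongrightarrow> y \<Longrightarrow> y = q"
  shows "g \<longlonglongrightarrow> q"
proof (rule ccontr)
  assume "\<not> g \<longlonglongrightarrow> q"
  then obtain e where e: "e > 0" "\<forall>N. \<exists>n\<ge>N. dist (g n) q \<ge> e"
    unfolding lim_sequentially by (meson not_less)
  then have "infinite {n. dist (g n) q \<ge> e}"
    unfolding infinite_nat_iff_unbounded_le by blast
  then obtain r :: "nat \<Rightarrow> nat" where r: "strict_mono r" "\<And>n. dist (g (r n)) q \<ge> e"
    using infinite_enumerate by blast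
  have "seq_compact (UNIV :: 'a set)"
    using assms(1) by (simp add: compact_eq_seq_compact_metric)
  then obtain y t where t: "strict_mono t" "((g \<circ> r) \<circ> t) \<longlonglongrightarrow> y"
    by (rule seq_compactE[where f = "g \<circ> r"]) auto
  have "y = q"
    using assms(2)[OF strict_mono_o[OF r(1) t(1)]] t(2) by (simp add: o_assoc)
  with t have "(\<lambda>n. dist (g (r (t n))) q) \<longlonglongrightarrow> 0"
    using tendsto_dist_iff[of "g \<circ> r \<circ> t" q sequentially] by (simp add: o_def)
  then have "e \<le> 0" by (rule LIMSEQ_le_const) (use r in auto)
  with e show False by simp
qed

lemma converging_semiorbits_compact:
  fixes f :: "nat \<Rightarrow> 'a::metric_space \<Rightarrow> 'a"
  assumes c: "compact (UNIV :: 'a set)"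
  shows "converging_semiorbits f x \<longleftrightarrow>
    (\<exists>p q. alpha_limit_set f x = {p} \<and> omega_limit_set f x = {q})"
proof -
  have q: "((\<lambda>n. tv_iterate f n x) \<longlongrightarrow> q) at_top" if "omega_limit_set f x = {q}" for q
  proof -
    have "(\<lambda>n. tv_iterate f (int n) x) \<longlonglongrightarrow> q"
    proof (rule unique_cluster_point_tendsto[OF c])
      fix r :: "nat \<Rightarrow> nat" and y
      assume "strict_mono r" and "((\<lambda>n. tv_iterate f (int n) x) \<circ> r) \<longlonglongrightarrow> y"
      then have "y \<in> omega_limit_set f x"
        unfolding omega_limit_set_def
        by (auto intro!: exI[of _ "\<lambda>k. int (r k)"] simp: tendsto_dist_iff[symmetric] o_def strict_mono_def)
      with that show "y = q" by simp
    qed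
    then have "((\<lambda>n. tv_iterate f (int (nat n)) x) \<longlongrightarrow> q) at_top"
      by (rule filterlim_compose) (rule filterlim_nat_sequentially)
    then show ?thesis
      by (rule Lim_transform_eventually) (use eventually_ge_at_top[of 0] in eventually_elim, simp)
  qed
  have p: "((\<lambda>n. tv_iterate f n x) \<longlongrightarrow> p) at_bot" if "alpha_limit_set f x = {p}" for p
  proof -
    have "(\<lambda>n. tv_iterate f (- int n) x) \<longlonglongrightarrow> p"
    proof (rule unique_cluster_point_tendsto[OF c])
      fix r :: "nat \<Rightarrow> nat" and y
      assume "strict_mono r" and "((\<lambda>n. tv_iterate f (- int n) x) \<circ> r) \<longlonglongrightarrow> y"
      then have "y \<in> alpha_limit_set f x"
        unfolding alpha_limit_set_def
        by (auto intro!: exI[of _ "\<lambda>k. - int (r k)"] simp: tendsto_dist_iff[symmetric] o_def strict_mono_def monotone_on_def)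
      with that show "y = p" by simp
    qed
    then have "((\<lambda>n. tv_iterate f (- int (nat n)) x) \<longlongrightarrow> p) at_top"
      by (rule filterlim_compose) (rule filterlim_nat_sequentially)
    then have "((\<lambda>n. tv_iterate f (- n) x) \<longlongrightarrow> p) at_top"
      by (rule Lim_transform_eventually) (use eventually_ge_at_top[of 0] in eventually_elim, simp)
    moreover have "filterlim uminus at_top (at_bot :: int filter)"
      unfolding filterlim_at_top eventually_at_bot_linorder
    proof
      fix Z :: int
      show "\<exists>N. \<forall>n\<le>N. Z \<le> - n" by (rule exI[of _ "- Z"]) simp
    qed
    ultimately have "((\<lambda>n. tv_iterate f (- (- n)) x) \<longlongrightarrow> p) at_bot"
      by (rule filterlim_compose)
    then show ?thesis by simp
  qed
  show ?thesis
    unfolding converging_semiorbits_def using p q by blast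
qed

end

(* Let delta be an expansivity constant and D a countable dense set.  The orbit of a point with
   converging semiorbits stays within delta/2 of a sequence in D that is constant near both
   ends of the integers.  There are only countably many such sequences, and two points whose
   orbits follow the same one lie in each other's delta-dynamical ball.  Hence countably many
   dynamical balls, all of measure zero, cover the points with converging semiorbits. *)
theory Submission
  imports Defs
begin

lemma forward_iterate_measurable:
  assumes "time_varying_bimeasurable f"
  shows "forward_iterate f n \<in> borel_measurable borel"
proof -
  have "f k \<in> borel_measurable borel" for k
    using assms by (simp add: time_varying_bimeasurable_def bimeasurable_def)
  then show ?thesis
    by (induction n) (auto intro: measurable_comp)
qed

lemma backward_iterate_measurable:
  assumes "time_varying_bimeasurable f"
  shows "backward_iterate f n \<in> borel_measurable borel"
proof -
  have "inv (f k) \<in> borel_measurable borel" for k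
    using assms by (simp add: time_varying_bimeasurable_def bimeasurable_def)
  then show ?thesis
    by (induction n) (auto intro: measurable_comp)
qed

lemma tv_iterate_measurable:
  assumes "time_varying_bimeasurable f"
  shows "tv_iterate f n \<in> borel_measurable borel"
  unfolding tv_iterate_def[abs_def]
  using forward_iterate_measurable[OF assms] backward_iterate_measurable[OF assms] by auto

text \<open>The integers are countable, so the ball is a countable intersection of preimages of
  closed balls under measurable iterates. This is needed because \<open>emeasure\<close> is 0 by
  convention off \<open>sets M\<close>, so that value 0 alone does not make a ball a null
  set.\<close>

lemma dynamical_ball_borel:
  assumes "time_varying_bimeasurable f"
  shows "dynamical_ball f \<delta> x \<in> sets borel"
proof -
  have "{y. dist (tv_iterate f n x) (tv_iterate f n y) \<le> \<delta>} \<in> sets borel" for n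
  proof -
    have "tv_iterate f n -` cball (tv_iterate f n x) \<delta> \<inter> space borel \<in> sets borel"
      by (rule measurable_sets[OF tv_iterate_measurable[OF assms]]) simp
    then show ?thesis
      by (simp add: vimage_def)
  qed
  then have "(\<Inter>n. {y. dist (tv_iterate f n x) (tv_iterate f n y) \<le> \<delta>}) \<in> sets borel"
    by (intro sets.countable_INT) auto
  moreover have "dynamical_ball f \<delta> x = (\<Inter>n. {y. dist (tv_iterate f n x) (tv_iterate f n y) \<le> \<delta>})"
    by (auto simp: dynamical_ball_def)
  ultimately show ?thesis
    by simp
qed

lemma mem_dynamical_ballI:
  assumes "\<And>n. dist (tv_iterate f n x) (g n) \<le> \<delta> / 2"
    and "\<And>n. dist (tv_iterate f n y) (g n) \<le> \<delta> / 2"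
  shows "y \<in> dynamical_ball f \<delta> x"
  unfolding dynamical_ball_def
proof (intro CollectI allI)
  fix n
  have "dist (tv_iterate f n x) (tv_iterate f n y)
      \<le> dist (tv_iterate f n x) (g n) + dist (tv_iterate f n y) (g n)"
    by (rule dist_triangle2)
  with assms[of n] show "dist (tv_iterate f n x) (tv_iterate f n y) \<le> \<delta>"
    by simp
qed

definition eventually_constant_seqs :: "'a set \<Rightarrow> (int \<Rightarrow> 'a) set" where
  "eventually_constant_seqs D =
     {g. range g \<subseteq> D \<and> (\<exists>N::nat. \<exists>p q. (\<forall>n < - int N. g n = p) \<and> (\<forall>n > int N. g n = q))}"

text \<open>Finite data determine such a sequence: the bound \<open>N\<close>, the two end values
  and the list of values on the window from \<open>- N\<close> to \<open>N\<close>.\<close>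

lemma countable_eventually_constant_seqs:
  assumes "countable D"
  shows "countable (eventually_constant_seqs D)"
proof -
  \<comment> \<open>Decodes these data; the shift by \<open>int N\<close> turns window positions
    into list indices from 0 to \<open>2 * N\<close>. Lists too short for the window do no harm,
    since only an inclusion in the image is claimed.\<close>
  define dec :: "nat \<times> 'a \<times> 'a \<times> 'a list \<Rightarrow> int \<Rightarrow> 'a" where
    "dec = (\<lambda>(N, p, q, l) n. if n < - int N then p else if n > int N then q else l ! nat (n + int N))"
  have "eventually_constant_seqs D \<subseteq> dec ` (UNIV \<times> D \<times> D \<times> lists D)"
  proof
    fix g :: "int \<Rightarrow> 'a" assume "g \<in> eventually_constant_seqs D"
    then obtain N p q where D: "\<And>n. g n \<in> D"
      and p: "\<And>n. n < - int N \<Longrightarrow> g n = p" and q: "\<And>n. n > int N \<Longrightarrow> g n = q"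
      unfolding eventually_constant_seqs_def by blast
    let ?l = "map g [- int N..int N]"
    have "g = dec (N, p, q, ?l)"
      by (rule ext) (auto simp: dec_def p q nth_map)
    moreover have "p \<in> D" "q \<in> D"
      using D[of "- int N - 1"] D[of "int N + 1"] p[of "- int N - 1"] q[of "int N + 1"] by auto
    ultimately show "g \<in> dec ` (UNIV \<times> D \<times> D \<times> lists D)"
      using D by (intro image_eqI) auto
  qed
  moreover have "countable (dec ` (UNIV \<times> D \<times> D \<times> lists D))"
    using assms by (intro countable_image countable_SIGMA countable_lists) auto
  ultimately show ?thesis
    by (rule countable_subset)
qed

text \<open>Convergence lets a single point of \<open>D\<close> near each limit serve a whole tail;
  the finitely many times between the tails are approximated one by one.\<close>

lemma converging_points_approx:
  assumes dense: "\<And>z e. e > 0 \<Longrightarrow> \<exists>c\<in>D. dist z c < e"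
    and "x \<in> converging_points f" and "e > 0"
  obtains g where "g \<in> eventually_constant_seqs D" "\<And>n. dist (tv_iterate f n x) (g n) < e"
proof -
  obtain p q where p: "((\<lambda>n. tv_iterate f n x) \<longlongrightarrow> p) at_bot"
    and q: "((\<lambda>n. tv_iterate f n x) \<longlongrightarrow> q) at_top"
    using assms(2) unfolding converging_points_def converging_semiorbits_def by blast
  obtain c where c: "\<And>z. c z \<in> D" "\<And>z. dist z (c z) < e"
    using dense[OF \<open>e > 0\<close>] by metis
  \<comment> \<open>The ball is centred at \<open>c p\<close> instead of \<open>p\<close>: it is
    open and contains \<open>p\<close>, so the tail is within \<open>e\<close> of \<open>c p\<close>
    without halving \<open>e\<close>.\<close>
  have "\<forall>\<^sub>F n in at_bot. tv_iterate f n x \<in> ball (c p) e"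
    by (rule topological_tendstoD[OF p]) (use c in \<open>auto simp: dist_commute\<close>)
  then obtain A where A: "\<And>n. n \<le> A \<Longrightarrow> dist (tv_iterate f n x) (c p) < e"
    by (auto simp: eventually_at_bot_linorder dist_commute)
  have "\<forall>\<^sub>F n in at_top. tv_iterate f n x \<in> ball (c q) e"
    by (rule topological_tendstoD[OF q]) (use c in \<open>auto simp: dist_commute\<close>)
  then obtain B where B: "\<And>n. n \<ge> B \<Longrightarrow> dist (tv_iterate f n x) (c q) < e"
    by (auto simp: eventually_at_top_linorder dist_commute)
  \<comment> \<open>With this bound, \<open>n < - int N\<close> forces \<open>n \<le> A\<close> and
    \<open>n > int N\<close> forces \<open>n \<ge> B\<close>.\<close>
  define N where "N = nat (max \<bar>A\<bar> \<bar>B\<bar>)"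
  define g where "g n = (if n < - int N then c p else if n > int N then c q
    else c (tv_iterate f n x))" for n
  show ?thesis
  proof
    have "range g \<subseteq> D" "\<forall>n < - int N. g n = c p" "\<forall>n > int N. g n = c q"
      using c by (auto simp: g_def)
    then show "g \<in> eventually_constant_seqs D"
      unfolding eventually_constant_seqs_def by blast
    show "dist (tv_iterate f n x) (g n) < e" for n
      using A[of n] B[of n] c by (auto simp: g_def N_def)
  qed
qed

lemma separable_space_euclideanE:
  assumes "separable_space (euclidean :: 'a::metric_space topology)"
  obtains D :: "'a::metric_space set" where "countable D" "\<And>z e. e > 0 \<Longrightarrow> \<exists>c\<in>D. dist z c < e"
proof -
  obtain D :: "'a set" where D: "countable D" "closure D = UNIV"
    using assms by (auto simp: separable_space_def)
  then have "\<exists>c\<in>D. dist z c < e" if "e > 0" for z e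
    using that closure_approachable[of z D] by (auto simp: dist_commute)
  with D(1) show ?thesis
    by (rule that)
qed

text \<open>Membership in \<open>null_sets (completion M)\<close> means being covered by a Borel set
  of measure zero, so the covering argument need not decide whether
  \<open>converging_points f\<close> is itself Borel.\<close>

theorem theorem3p16:
  fixes f :: "nat \<Rightarrow> 'a::metric_space \<Rightarrow> 'a" and M :: "'a measure"
  assumes "separable_space (euclidean :: 'a topology)"
    and "time_varying_bimeasurable f"
    and "sets M = sets borel"
    and "outer_regular_measure M"
    and "non_atomic M"
    and "expansive_measure f M"
  shows "converging_points f \<in> null_sets (completion M)"
proof -
  obtain D :: "'a set" where D: "countable D" "\<And>z e. e > 0 \<Longrightarrow> \<exists>c\<in>D. dist z c < e"
    using separable_space_euclideanE[OF assms(1)] by blast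
  obtain \<delta> where \<delta>: "\<delta> > 0" "\<And>x. emeasure M (dynamical_ball f \<delta> x) = 0"
    using assms(6) unfolding expansive_measure_def by blast
  have null: "dynamical_ball f \<delta> x \<in> null_sets M" for x
    using dynamical_ball_borel[OF assms(2)] \<delta>(2) assms(3) by (simp add: null_sets_def)
  define follows where "follows x g \<longleftrightarrow> (\<forall>n. dist (tv_iterate f n x) (g n) \<le> \<delta> / 2)" for x g
  \<comment> \<open>Centres are chosen per sequence, not per point, which keeps the union countable.
    If no point follows \<open>g\<close>, \<open>SOME\<close> yields an arbitrary centre, whose ball
    is null all the same.\<close>
  define S where "S = (\<Union>g\<in>eventually_constant_seqs D. dynamical_ball f \<delta> (SOME x. follows x g))"
  have "S \<in> null_sets M"
    unfolding S_def
    by (intro null_sets_UN' countable_eventually_constant_seqs D(1) null)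
  moreover have "converging_points f \<subseteq> S"
  proof
    fix y assume y: "y \<in> converging_points f"
    obtain g where g: "g \<in> eventually_constant_seqs D" "\<And>n. dist (tv_iterate f n y) (g n) < \<delta> / 2"
      using converging_points_approx[OF D(2) y, of "\<delta> / 2"] \<delta>(1) by auto
    then have *: "follows y g"
      unfolding follows_def using less_imp_le by blast
    then have "follows (SOME x. follows x g) g"
      by (rule someI)
    with * have "y \<in> dynamical_ball f \<delta> (SOME x. follows x g)"
      unfolding follows_def by (intro mem_dynamical_ballI[of _ _ g]) auto
    with g(1) show "y \<in> S"
      unfolding S_def by blast
  qed
  ultimately show ?thesis
    by (rule null_sets_completion_subset[rotated, OF null_sets_completionI])
qed

end
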